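(* Let $(X,d)$ be a complete metric space and let $T:X\to P_{cl}(X)$ be an operator such that $SFix(T)\neq\emptyset$. Suppose there exist $\alpha,\beta,\gamma\ge 0$ with $\alpha+\beta+\gamma<1$ such that $$H(T(x),T(y))\le \alpha\, d(x,y)+\beta\, D(x,T(y))+\gamma\, D(y,T(x))\quad\text{for all } x,y\in X.$$ Then the strict fixed point problem $T(x)=\{x\}$ is well-posed in the sense of Reich and Zaslavski.
   Context: For a metric space $(X,d)$, $P(X)$ is the family of all nonempty subsets of $X$ and $P_{cl}(X)$ the family of all nonempty closed subsets. For $T:X\to P(X)$, $SFix(T)=\{x\in X: T(x)=\{x\}\}$. For $A,B\in P(X)$: $D(A,B)=\inf\{d(a,b):a\in A,b\in B\}$, with $D(x,B):=D(\{x\},B)$; $e(A,B)=\sup\{D(a,B):a\in A\}\in[0,+\infty]$; $H(A,B)=\max\{e(A,B),e(B,A)\}\in[0,+\infty]$. The strict fixed point problem $T(x)=\{x\}$ is well-posed in the sense of Reich and Zaslavski if $SFix(T)=\{x^*\}$ for some $x^*\in X$ and, for every sequence $(u_n)_{n\in\mathbb{N}}\subset X$, $D(u_n,T(u_n))\to 0$ implies $u_n\to x^*$ as $n\to\infty$. *)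

theory Defs
  imports "HOL-Analysis.Analysis"
begin

text \<open>
  The gap functional \<open>D(A,B)\<close> on nonempty sets is the library's \<^const>\<open>setdist\<close>, and
  \<open>D(x,B)\<close> is \<open>setdist {x} B\<close>. The excess and the Pompeiu-Hausdorff functional take values
  in \<open>[0,\<infinity>]\<close>, since the sets involved may be unbounded; hence \<^typ>\<open>ennreal\<close>.
\<close>

definition P_cl :: "'a::metric_space set set"
  where "P_cl = {A. A \<noteq> {} \<and> closed A}"

definition SFix :: "('a \<Rightarrow> 'a set) \<Rightarrow> 'a set"
  where "SFix T = {x. T x = {x}}"

definition excess :: "'a::metric_space set \<Rightarrow> 'a set \<Rightarrow> ennreal"
  where "excess A B = (SUP a\<in>A. ennreal (setdist {a} B))"

definition PH :: "'a::metric_space set \<Rightarrow> 'a set \<Rightarrow> ennreal"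
  where "PH A B = max (excess A B) (excess B A)"

definition well_posed_RZ :: "('a::metric_space \<Rightarrow> 'a set) \<Rightarrow> bool"
  where "well_posed_RZ T \<longleftrightarrow>
    (\<exists>x. SFix T = {x} \<and>
      (\<forall>u :: nat \<Rightarrow> 'a.
        (\<lambda>n. setdist {u n} (T (u n))) \<longlonglongrightarrow> 0 \<longrightarrow> u \<longlonglongrightarrow> x))"

end

theory Submission
  imports Defs
begin

text \<open>
  Let \<open>p\<close> be a strict fixed point. The contraction condition between \<open>x\<close> and \<open>p\<close> pulls every
  \<open>z \<in> T x\<close> towards \<open>p\<close>: since \<open>T p\<close> is the singleton \<open>{p}\<close>, the excess of \<open>T x\<close> over it
  dominates \<open>dist z p\<close> for each such \<open>z\<close>, and the term \<open>D(p, T x)\<close> on the right is itself at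
  most \<open>dist z p\<close>, so it can be absorbed on the left. Hence
  \<open>(1 - \<gamma>) dist z p \<le> (\<alpha> + \<beta>) dist x p\<close> for all \<open>z \<in> T x\<close>.

  By the triangle inequality a point \<open>x\<close> far from \<open>p\<close> is then also far from its image. The
  quantitative form, \<open>dist_strict_fixed_point_le\<close>, reads
  \<open>(1 - \<alpha> - \<beta> - \<gamma>) dist x p \<le> D(x, T x)\<close>. It carries the whole result: if \<open>x\<close> is a strict
  fixed point, the right-hand side vanishes and \<open>x = p\<close>; and if \<open>D(u n, T (u n))\<close> tends to
  \<open>0\<close>, so does \<open>dist (u n) p\<close>.
\<close>

lemma setdist_le_PH:
  assumes "a \<in> A" and "PH A B \<le> ennreal r" and "r \<ge> 0"
  shows "setdist {a} B \<le> r"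
proof -
  have "ennreal (setdist {a} B) \<le> excess A B"
    unfolding excess_def using assms(1) by (rule SUP_upper)
  also have "\<dots> \<le> PH A B"
    by (simp add: PH_def)
  also note assms(2)
  finally show ?thesis
    using assms(3) by simp
qed

text \<open>
  The term \<open>\<gamma> * setdist {p} (T x)\<close> has no bound in terms of \<open>dist x p\<close> at the outset; it is
  compared with the very distance \<open>dist z p\<close> that is being estimated and moved to the left,
  which explains the factor \<open>1 - \<gamma>\<close>.
\<close>

lemma dist_image_strict_fixed_point_le:
  fixes T :: "'a::metric_space \<Rightarrow> 'a set"
  assumes p: "T p = {p}" and z: "z \<in> T x"
    and nonneg: "\<alpha> \<ge> 0" "\<beta> \<ge> 0" "\<gamma> \<ge> 0"
    and contr: "PH (T x) (T p) \<le>
      ennreal (\<alpha> * dist x p + \<beta> * setdist {x} (T p) + \<gamma> * setdist {p} (T x))"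
  shows "(1 - \<gamma>) * dist z p \<le> (\<alpha> + \<beta>) * dist x p"
proof -
  have "setdist {z} (T p) \<le> \<alpha> * dist x p + \<beta> * setdist {x} (T p) + \<gamma> * setdist {p} (T x)"
    using z contr by (rule setdist_le_PH) (simp add: nonneg setdist_pos_le)
  then have "dist z p \<le> \<alpha> * dist x p + \<beta> * dist x p + \<gamma> * setdist {p} (T x)"
    by (simp add: p)
  moreover have "setdist {p} (T x) \<le> dist z p"
    using z by (simp add: setdist_le_dist dist_commute)
  then have "\<gamma> * setdist {p} (T x) \<le> \<gamma> * dist z p"
    using nonneg by (simp add: mult_left_mono)
  ultimately show ?thesis
    by (simp add: algebra_simps)
qed

text \<open>
  On the way from \<open>x\<close> to \<open>p\<close> through an arbitrary \<open>z \<in> T x\<close>, the second leg, weighted by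
  \<open>1 - \<gamma>\<close>, costs at most \<open>(\<alpha> + \<beta>) dist x p\<close>; the first leg has to pay for the rest,
  whichever \<open>z\<close> is chosen. The bound is informative exactly when \<open>\<alpha> + \<beta> + \<gamma> < 1\<close>.
\<close>

lemma dist_strict_fixed_point_le:
  fixes T :: "'a::metric_space \<Rightarrow> 'a set"
  assumes p: "T p = {p}" and ne: "T x \<noteq> {}"
    and nonneg: "\<alpha> \<ge> 0" "\<beta> \<ge> 0" "\<gamma> \<ge> 0" and "\<gamma> \<le> 1"
    and contr: "PH (T x) (T p) \<le>
      ennreal (\<alpha> * dist x p + \<beta> * setdist {x} (T p) + \<gamma> * setdist {p} (T x))"
  shows "(1 - \<alpha> - \<beta> - \<gamma>) * dist x p \<le> setdist {x} (T x)"
proof (rule le_setdistI)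
  fix x' z assume "x' \<in> {x}" and z: "z \<in> T x"
  have "(1 - \<gamma>) * dist x p \<le> (1 - \<gamma>) * (dist x z + dist z p)"
    using \<open>\<gamma> \<le> 1\<close> by (intro mult_left_mono dist_triangle) simp
  moreover have "(1 - \<gamma>) * dist z p \<le> (\<alpha> + \<beta>) * dist x p"
    using p z nonneg contr by (rule dist_image_strict_fixed_point_le)
  moreover have "(1 - \<gamma>) * dist x z \<le> dist x z"
    using nonneg by (simp add: mult_left_le_one_le \<open>\<gamma> \<le> 1\<close>)
  ultimately show "(1 - \<alpha> - \<beta> - \<gamma>) * dist x p \<le> dist x' z"
    using \<open>x' \<in> {x}\<close> by (simp add: algebra_simps)
qed (use ne in auto)

theorem theorem2p3:
  fixes T :: "'a::complete_space \<Rightarrow> 'a set"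
  assumes "\<forall>x. T x \<in> P_cl"
    and "SFix T \<noteq> {}"
    and "\<exists>\<alpha> \<beta> \<gamma> :: real. \<alpha> \<ge> 0 \<and> \<beta> \<ge> 0 \<and> \<gamma> \<ge> 0 \<and> \<alpha> + \<beta> + \<gamma> < 1 \<and>
      (\<forall>x y. PH (T x) (T y) \<le>
        ennreal (\<alpha> * dist x y + \<beta> * setdist {x} (T y) + \<gamma> * setdist {y} (T x)))"
  shows "well_posed_RZ T"
proof -
  obtain \<alpha> \<beta> \<gamma> :: real where nonneg: "\<alpha> \<ge> 0" "\<beta> \<ge> 0" "\<gamma> \<ge> 0" and less: "\<alpha> + \<beta> + \<gamma> < 1"
    and contr: "\<And>x y. PH (T x) (T y) \<le>
      ennreal (\<alpha> * dist x y + \<beta> * setdist {x} (T y) + \<gamma> * setdist {y} (T x))"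
    using assms(3) by blast
  obtain p where p: "T p = {p}"
    using assms(2) by (auto simp: SFix_def)
  define c where "c = 1 - \<alpha> - \<beta> - \<gamma>"
  have "c > 0"
    using less by (simp add: c_def)
  have "c * dist x p \<le> setdist {x} (T x)" for x
    unfolding c_def
  proof (rule dist_strict_fixed_point_le[of T p x, OF p _ nonneg _ contr])
    show "T x \<noteq> {}"
      using assms(1) by (auto simp: P_cl_def)
    show "\<gamma> \<le> 1"
      using nonneg less by linarith
  qed
  then have bound: "dist x p \<le> setdist {x} (T x) / c" for x
    using \<open>c > 0\<close> by (simp add: field_simps)
  have unique: "x = p" if "T x = {x}" for x
    using bound[of x] that by simp
  have "u \<longlonglongrightarrow> p" if "(\<lambda>n. setdist {u n} (T (u n))) \<longlonglongrightarrow> 0" for u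
  proof -
    have "(\<lambda>n. setdist {u n} (T (u n)) / c) \<longlonglongrightarrow> 0"
      using that by (rule tendsto_divide_zero)
    then have "(\<lambda>n. dist (u n) p) \<longlonglongrightarrow> 0"
      by (rule Lim_null_comparison[rotated]) (simp add: bound)
    then show ?thesis
      by (rule tendsto_dist_iff[THEN iffD2])
  qed
  moreover have "SFix T = {p}"
    unfolding SFix_def using p unique by blast
  ultimately show ?thesis
    unfolding well_posed_RZ_def by blast
qed

end
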